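(* Let $\alpha>0$. If $(\rho,u)$ is an entropy solution of the coupled Burgers system $$\partial_t\rho+\partial_x(\rho u)=0,\qquad \partial_tu+\partial_x\Big(\frac{u^2+\alpha\rho^2}{2}\Big)=0,\qquad x\in\mathbb{R},\ t>0,$$ then $f_\pm=u\pm\sqrt\alpha\,\rho$ are entropy solutions of the decoupled Burgers equations $$\partial_tf_++f_+\partial_xf_+=0,\qquad \partial_tf_-+f_-\partial_xf_-=0,\qquad x\in\mathbb{R},\ t>0.$$ Conversely, if $f_\pm$ with $f_+\ge f_-$ are entropy solutions of the decoupled Burgers equations, then $(\rho,u)=\Big(\frac{f_+-f_-}{2\sqrt\alpha},\frac{f_++f_-}{2}\Big)$ is an entropy solution of the coupled Burgers system.
   Context: Entropy pairs for the coupled system: for convex functions $\psi_1,\psi_2\in C^2(\mathbb{R})$ and real numbers $k_1,k_2\ge0$, let $$\eta(\rho,u)=k_1\psi_1(u+\sqrt\alpha\rho)+k_2\psi_2(u-\sqrt\alpha\rho),\qquad q(\rho,u)=k_1\phi_1(u+\sqrt\alpha\rho)+k_2\phi_2(u-\sqrt\alpha\rho),$$ where $\phi_i'(v)=v\psi_i'(v)$ for $v\in\mathbb{R}$, $i=1,2$. A couple $(\rho,u)$ of bounded measurable functions on $\mathbb{R}\times(0,\infty)$ is an entropy solution of the coupled Burgers system if $\rho\ge0$ and $\partial_t\eta(\rho,u)+\partial_xq(\rho,u)\le0$ in the sense of distributions for every such pair $(\eta,q)$. A bounded measurable function $f$ on $\mathbb{R}\times(0,\infty)$ is an entropy solution of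 the Burgers equation $\partial_tf+f\partial_xf=0$ if $\partial_t\psi(f)+\partial_x\phi(f)\le0$ in the sense of distributions for every convex $\psi\in C^2(\mathbb{R})$, where $\phi'(v)=v\psi'(v)$. *)

theory Defs
  imports "HOL-Analysis.Analysis"
begin

(* A function is C^(k+1) iff it is Frechet differentiable and all its directional
   derivatives are C^k. *)
primrec C_k :: "nat \<Rightarrow> ('a::euclidean_space \<Rightarrow> real) \<Rightarrow> bool" where
  "C_k 0 f \<longleftrightarrow> continuous_on UNIV f"
| "C_k (Suc k) f \<longleftrightarrow>
     (\<forall>z. f differentiable (at z)) \<and> (\<forall>v. C_k k (\<lambda>z. frechet_derivative f (at z) v))"

definition smooth :: "('a::euclidean_space \<Rightarrow> real) \<Rightarrow> bool" where
  "smooth f \<longleftrightarrow> (\<forall>k. C_k k f)"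

(* Points are pairs z = (x, t), with space first and time second.  Functions on the
   half-plane are total functions whose values for t \<le> 0 are never used. *)
definition half_plane :: "(real \<times> real) set" where
  "half_plane = UNIV \<times> {0<..}"

definition bounded_measurable :: "(real \<times> real \<Rightarrow> real) \<Rightarrow> bool" where
  "bounded_measurable f \<longleftrightarrow>
     f \<in> borel_measurable (lebesgue_on half_plane) \<and> bounded (f ` half_plane)"

definition dx :: "(real \<times> real \<Rightarrow> real) \<Rightarrow> real \<times> real \<Rightarrow> real" where
  "dx \<theta> = (\<lambda>(x, t). deriv (\<lambda>y. \<theta> (y, t)) x)"

definition dt :: "(real \<times> real \<Rightarrow> real) \<Rightarrow> real \<times> real \<Rightarrow> real" where
  "dt \<theta> = (\<lambda>(x, t). deriv (\<lambda>s. \<theta> (x, s)) t)"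

(* Test functions on the open half-plane, extended by zero to the whole plane. *)
definition test_function :: "(real \<times> real \<Rightarrow> real) \<Rightarrow> bool" where
  "test_function \<theta> \<longleftrightarrow>
     smooth \<theta> \<and> compact (closure {z. \<theta> z \<noteq> 0}) \<and> closure {z. \<theta> z \<noteq> 0} \<subseteq> half_plane"

(* The distribution \<partial>\<^sub>t g + \<partial>\<^sub>x h on the half-plane, applied to \<theta>. *)
definition distr_div ::
    "(real \<times> real \<Rightarrow> real) \<Rightarrow> (real \<times> real \<Rightarrow> real) \<Rightarrow> (real \<times> real \<Rightarrow> real) \<Rightarrow> real" where
  "distr_div g h \<theta> =
     - set_lebesgue_integral lebesgue half_plane (\<lambda>z. g z * dt \<theta> z + h z * dx \<theta> z)"

definition distr_div_nonpos ::
    "(real \<times> real \<Rightarrow> real) \<Rightarrow> (real \<times> real \<Rightarrow> real) \<Rightarrow> bool" where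
  "distr_div_nonpos g h \<longleftrightarrow>
     (\<forall>\<theta>. test_function \<theta> \<and> (\<forall>z. 0 \<le> \<theta> z) \<longrightarrow> distr_div g h \<theta> \<le> 0)"

definition burgers_entropy_pair :: "(real \<Rightarrow> real) \<Rightarrow> (real \<Rightarrow> real) \<Rightarrow> bool" where
  "burgers_entropy_pair \<psi> \<phi> \<longleftrightarrow>
     convex_on UNIV \<psi> \<and> C_k 2 \<psi> \<and> (\<forall>v. (\<phi> has_real_derivative v * deriv \<psi> v) (at v))"

definition burgers_entropy_solution :: "(real \<times> real \<Rightarrow> real) \<Rightarrow> bool" where
  "burgers_entropy_solution f \<longleftrightarrow>
     bounded_measurable f \<and>
     (\<forall>\<psi> \<phi>. burgers_entropy_pair \<psi> \<phi> \<longrightarrow> distr_div_nonpos (\<lambda>z. \<psi> (f z)) (\<lambda>z. \<phi> (f z)))"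

definition coupled_entropy_pair ::
    "real \<Rightarrow> (real \<Rightarrow> real \<Rightarrow> real) \<Rightarrow> (real \<Rightarrow> real \<Rightarrow> real) \<Rightarrow> bool" where
  "coupled_entropy_pair \<alpha> \<eta> q \<longleftrightarrow>
     (\<exists>k\<^sub>1 k\<^sub>2 \<psi>\<^sub>1 \<psi>\<^sub>2 \<phi>\<^sub>1 \<phi>\<^sub>2.
        0 \<le> k\<^sub>1 \<and> 0 \<le> k\<^sub>2 \<and> burgers_entropy_pair \<psi>\<^sub>1 \<phi>\<^sub>1 \<and> burgers_entropy_pair \<psi>\<^sub>2 \<phi>\<^sub>2 \<and>
        \<eta> = (\<lambda>\<rho> u. k\<^sub>1 * \<psi>\<^sub>1 (u + sqrt \<alpha> * \<rho>) + k\<^sub>2 * \<psi>\<^sub>2 (u - sqrt \<alpha> * \<rho>)) \<and>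
        q = (\<lambda>\<rho> u. k\<^sub>1 * \<phi>\<^sub>1 (u + sqrt \<alpha> * \<rho>) + k\<^sub>2 * \<phi>\<^sub>2 (u - sqrt \<alpha> * \<rho>)))"

definition coupled_entropy_solution ::
    "real \<Rightarrow> (real \<times> real \<Rightarrow> real) \<Rightarrow> (real \<times> real \<Rightarrow> real) \<Rightarrow> bool" where
  "coupled_entropy_solution \<alpha> \<rho> u \<longleftrightarrow>
     bounded_measurable \<rho> \<and> bounded_measurable u \<and> (\<forall>z\<in>half_plane. 0 \<le> \<rho> z) \<and>
     (\<forall>\<eta> q. coupled_entropy_pair \<alpha> \<eta> q \<longrightarrow>
        distr_div_nonpos (\<lambda>z. \<eta> (\<rho> z) (u z)) (\<lambda>z. q (\<rho> z) (u z)))"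

end

theory Submission
  imports Defs
begin

text \<open>
  Choosing \<open>k\<^sub>1 = 1, k\<^sub>2 = 0\<close> or \<open>k\<^sub>1 = 0, k\<^sub>2 = 1\<close> in an entropy pair of the coupled system leaves
  an arbitrary Burgers entropy pair evaluated at \<open>u + sqrt \<alpha> * \<rho>\<close> or at \<open>u - sqrt \<alpha> * \<rho>\<close>, which
  gives the entropy inequalities of the decoupled equations.

  Conversely, for \<open>\<rho> = (f\<^sub>p - f\<^sub>m) / (2 * sqrt \<alpha>)\<close> and \<open>u = (f\<^sub>p + f\<^sub>m) / 2\<close> these two combinations
  are \<open>f\<^sub>p\<close> and \<open>f\<^sub>m\<close>, so a coupled entropy inequality is a combination, with nonnegative
  coefficients, of one entropy inequality for \<open>f\<^sub>p\<close> and one for \<open>f\<^sub>m\<close>.  The analytic content is the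
  linearity of the pairing with a test function (lemma \<open>distr_div_linear_combination\<close>).  It rests
  on integrability: an entropy or a flux is continuous, so it stays bounded and measurable when
  evaluated at a bounded measurable function, while the derivatives of a test function are
  continuous with compact support.
\<close>

lemma half_plane_lebesgue [measurable]: "half_plane \<in> sets lebesgue"
proof -
  have "open half_plane"
    unfolding half_plane_def by (intro open_Times) auto
  then show ?thesis by (simp add: borel_open)
qed

lemma bounded_measurable_linear_combination:
  assumes "bounded_measurable f" "bounded_measurable g"
  shows "bounded_measurable (\<lambda>z. a * f z + b * g z)"
proof -
  have "bounded ((\<lambda>z. a * f z + b * g z) ` half_plane)"
    using assms
      bounded_scaling[of "f ` half_plane" a] bounded_scaling[of "g ` half_plane" b]
    unfolding bounded_measurable_def
    by (intro bounded_plus_comp) (simp_all add: image_image)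
  then show ?thesis
    using assms unfolding bounded_measurable_def by auto
qed

lemma bounded_measurable_continuous_compose:
  assumes f: "bounded_measurable f" and c: "continuous_on UNIV h"
  shows "bounded_measurable (\<lambda>z. h (f z))"
proof -
  have "compact (closure (f ` half_plane))"
    using f by (simp add: bounded_measurable_def)
  then have "bounded (h ` closure (f ` half_plane))"
    by (metis c compact_continuous_image compact_imp_bounded continuous_on_subset subset_UNIV)
  then have "bounded ((\<lambda>z. h (f z)) ` half_plane)"
    by (rule bounded_subset) (use closure_subset in fastforce)
  moreover have "h \<in> borel_measurable borel"
    by (rule borel_measurable_continuous_onI[OF c])
  then have "(\<lambda>z. h (f z)) \<in> borel_measurable (lebesgue_on half_plane)"
    using f unfolding bounded_measurable_def by (auto intro: measurable_compose)
  ultimately show ?thesis by (simp add: bounded_measurable_def)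
qed

lemma burgers_entropy_pair_continuous:
  assumes "burgers_entropy_pair \<psi> \<phi>"
  shows "continuous_on UNIV \<psi>" "continuous_on UNIV \<phi>"
proof -
  have "\<forall>z. \<psi> differentiable (at z)"
    using assms by (simp add: burgers_entropy_pair_def numeral_2_eq_2)
  then show "continuous_on UNIV \<psi>"
    by (simp add: continuous_on_eq_continuous_at differentiable_imp_continuous_within)
  show "continuous_on UNIV \<phi>"
    using assms unfolding burgers_entropy_pair_def
    by (meson DERIV_isCont continuous_at_imp_continuous_on)
qed

lemma directional_derivative_integrable:
  fixes \<theta> :: "'a::euclidean_space \<Rightarrow> real"
  assumes "smooth \<theta>" and K: "compact (closure {z. \<theta> z \<noteq> 0})"
  shows "integrable lebesgue (\<lambda>z. frechet_derivative \<theta> (at z) v)"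
proof -
  let ?D = "\<lambda>z. frechet_derivative \<theta> (at z) v" and ?K = "closure {z. \<theta> z \<noteq> 0}"
  have "C_k (Suc 0) \<theta>"
    using assms(1) by (auto simp: smooth_def)
  then have c: "continuous_on UNIV ?D"
    by simp
  have zero: "?D z = 0" if "z \<notin> ?K" for z
  proof -
    \<comment> \<open>On the open complement of the support \<open>\<theta>\<close> coincides with the zero function.\<close>
    have eq: "0 = \<theta> y" if "y \<in> - ?K" for y
      using that closure_subset[of "{z. \<theta> z \<noteq> 0}"] by auto
    have "open (- ?K)"
      by (simp add: open_Compl)
    then have "(\<theta> has_derivative (\<lambda>_. 0)) (at z)"
      by (rule has_derivative_transform_within_open[OF has_derivative_const _ _ eq])
         (simp add: that)
    then show ?thesis
      by (metis frechet_derivative_at)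
  qed
  have "integrable lborel (\<lambda>z. indicator ?K z *\<^sub>R ?D z)"
    by (rule borel_integrable_compact[OF K continuous_on_subset[OF c]]) simp
  moreover have "(\<lambda>z. indicator ?K z *\<^sub>R ?D z) = ?D"
    using zero by (fastforce simp: fun_eq_iff indicator_def)
  ultimately show ?thesis
    by (metis integrable_completion borel_measurable_integrable)
qed

lemma partial_derivatives_eq_frechet:
  assumes "smooth \<theta>"
  shows "dx \<theta> = (\<lambda>z. frechet_derivative \<theta> (at z) (1, 0))"
    and "dt \<theta> = (\<lambda>z. frechet_derivative \<theta> (at z) (0, 1))"
proof -
  have "C_k (Suc 0) \<theta>"
    using assms by (auto simp: smooth_def)
  then have D: "(\<theta> has_derivative frechet_derivative \<theta> (at z)) (at z)" for z
    by (simp only: C_k.simps frechet_derivative_works)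
  have lin: "frechet_derivative \<theta> (at z) (r *\<^sub>R v) = r * frechet_derivative \<theta> (at z) v" for z r v
    using linear_scale[OF has_derivative_linear[OF D]] by simp
  have "dx \<theta> (x, t) = frechet_derivative \<theta> (at (x, t)) (1, 0)" for x t
  proof -
    have "((\<lambda>y. \<theta> (y, t)) has_derivative (\<lambda>r. frechet_derivative \<theta> (at (x, t)) (r, 0))) (at x)"
      by (rule has_derivative_compose[of "\<lambda>y. (y, t)", OF _ D]) (auto intro!: derivative_eq_intros)
    moreover have "(\<lambda>r. frechet_derivative \<theta> (at (x, t)) (r, 0))
        = (*) (frechet_derivative \<theta> (at (x, t)) (1, 0))"
    proof
      show "frechet_derivative \<theta> (at (x, t)) (r, 0) = frechet_derivative \<theta> (at (x, t)) (1, 0) * r" for r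
        using lin[of "(x, t)" r "(1, 0)"] by (simp add: mult.commute)
    qed
    ultimately have "((\<lambda>y. \<theta> (y, t)) has_real_derivative frechet_derivative \<theta> (at (x, t)) (1, 0)) (at x)"
      by (simp only: has_field_derivative_def)
    then show ?thesis
      by (simp add: dx_def DERIV_imp_deriv)
  qed
  then show "dx \<theta> = (\<lambda>z. frechet_derivative \<theta> (at z) (1, 0))"
    by auto
  have "dt \<theta> (x, t) = frechet_derivative \<theta> (at (x, t)) (0, 1)" for x t
  proof -
    have "((\<lambda>s. \<theta> (x, s)) has_derivative (\<lambda>r. frechet_derivative \<theta> (at (x, t)) (0, r))) (at t)"
      by (rule has_derivative_compose[of "\<lambda>s. (x, s)", OF _ D]) (auto intro!: derivative_eq_intros)
    moreover have "(\<lambda>r. frechet_derivative \<theta> (at (x, t)) (0, r))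
        = (*) (frechet_derivative \<theta> (at (x, t)) (0, 1))"
    proof
      show "frechet_derivative \<theta> (at (x, t)) (0, r) = frechet_derivative \<theta> (at (x, t)) (0, 1) * r" for r
        using lin[of "(x, t)" r "(0, 1)"] by (simp add: mult.commute)
    qed
    ultimately have "((\<lambda>s. \<theta> (x, s)) has_real_derivative frechet_derivative \<theta> (at (x, t)) (0, 1)) (at t)"
      by (simp only: has_field_derivative_def)
    then show ?thesis
      by (simp add: dt_def DERIV_imp_deriv)
  qed
  then show "dt \<theta> = (\<lambda>z. frechet_derivative \<theta> (at z) (0, 1))"
    by auto
qed

lemma bounded_measurable_times_integrable:
  assumes "bounded_measurable g" and D: "integrable lebesgue D"
  shows "set_integrable lebesgue half_plane (\<lambda>z. g z * D z)"
proof -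
  obtain B where B: "\<And>z. z \<in> half_plane \<Longrightarrow> \<bar>g z\<bar> \<le> B"
    using assms(1) by (auto simp: bounded_measurable_def bounded_iff)
  have "g \<in> borel_measurable (lebesgue_on half_plane)"
    using assms(1) by (simp add: bounded_measurable_def)
  then have [measurable]: "(\<lambda>z. indicator half_plane z *\<^sub>R g z) \<in> borel_measurable lebesgue"
    by (subst (asm) borel_measurable_restrict_space_iff) (auto simp: mult.commute)
  have [measurable]: "D \<in> borel_measurable lebesgue"
    using D by simp
  have "integrable lebesgue (\<lambda>z. (indicator half_plane z *\<^sub>R g z) * D z)"
  proof (rule Bochner_Integration.integrable_bound[of _ "\<lambda>z. \<bar>B\<bar> * \<bar>D z\<bar>"])
    show "integrable lebesgue (\<lambda>z. \<bar>B\<bar> * \<bar>D z\<bar>)"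
      using D by simp
    show "AE z in lebesgue.
        norm ((indicator half_plane z *\<^sub>R g z) * D z) \<le> norm (\<bar>B\<bar> * \<bar>D z\<bar>)"
      using B by (intro AE_I2) (fastforce simp: indicator_def abs_mult intro!: mult_right_mono)
  qed measurable
  then show ?thesis
    by (simp add: set_integrable_def mult.assoc)
qed

lemma distr_div_integrable:
  assumes "bounded_measurable g" "bounded_measurable h" "test_function \<theta>"
  shows "set_integrable lebesgue half_plane (\<lambda>z. g z * dt \<theta> z + h z * dx \<theta> z)"
  using assms unfolding test_function_def
  by (intro set_integral_add bounded_measurable_times_integrable)
     (auto simp: partial_derivatives_eq_frechet directional_derivative_integrable)

lemma distr_div_linear_combination:
  assumes "bounded_measurable g\<^sub>1" "bounded_measurable h\<^sub>1"
    and "bounded_measurable g\<^sub>2" "bounded_measurable h\<^sub>2" and "test_function \<theta>"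
  shows "distr_div (\<lambda>z. a * g\<^sub>1 z + b * g\<^sub>2 z) (\<lambda>z. a * h\<^sub>1 z + b * h\<^sub>2 z) \<theta>
    = a * distr_div g\<^sub>1 h\<^sub>1 \<theta> + b * distr_div g\<^sub>2 h\<^sub>2 \<theta>"
proof -
  let ?F = "\<lambda>g h z. g z * dt \<theta> z + h z * dx \<theta> z"
  have "(\<lambda>z. (a * g\<^sub>1 z + b * g\<^sub>2 z) * dt \<theta> z + (a * h\<^sub>1 z + b * h\<^sub>2 z) * dx \<theta> z)
      = (\<lambda>z. a * ?F g\<^sub>1 h\<^sub>1 z + b * ?F g\<^sub>2 h\<^sub>2 z)"
    by (auto simp: algebra_simps)
  moreover have "set_integrable lebesgue half_plane (\<lambda>z. a * ?F g\<^sub>1 h\<^sub>1 z)"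
    "set_integrable lebesgue half_plane (\<lambda>z. b * ?F g\<^sub>2 h\<^sub>2 z)"
    using assms by (simp_all add: distr_div_integrable)
  ultimately show ?thesis
    by (simp add: distr_div_def set_integral_add(2))
qed

lemma distr_div_nonpos_linear_combination:
  assumes "bounded_measurable g\<^sub>1" "bounded_measurable h\<^sub>1"
    and "bounded_measurable g\<^sub>2" "bounded_measurable h\<^sub>2"
    and "distr_div_nonpos g\<^sub>1 h\<^sub>1" "distr_div_nonpos g\<^sub>2 h\<^sub>2" and "0 \<le> a" "0 \<le> b"
  shows "distr_div_nonpos (\<lambda>z. a * g\<^sub>1 z + b * g\<^sub>2 z) (\<lambda>z. a * h\<^sub>1 z + b * h\<^sub>2 z)"
  using assms
  by (auto simp: distr_div_nonpos_def distr_div_linear_combination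
      intro!: add_nonpos_nonpos mult_nonneg_nonpos)

lemma burgers_entropy_solution_of_coupled:
  assumes "coupled_entropy_solution \<alpha> \<rho> u"
  shows "burgers_entropy_solution (\<lambda>z. u z + sqrt \<alpha> * \<rho> z)"
    and "burgers_entropy_solution (\<lambda>z. u z - sqrt \<alpha> * \<rho> z)"
proof -
  have b: "bounded_measurable u" "bounded_measurable \<rho>"
    and ineq: "\<And>\<eta> q. coupled_entropy_pair \<alpha> \<eta> q \<Longrightarrow>
      distr_div_nonpos (\<lambda>z. \<eta> (\<rho> z) (u z)) (\<lambda>z. q (\<rho> z) (u z))"
    using assms by (auto simp: coupled_entropy_solution_def)
  have "bounded_measurable (\<lambda>z. u z + sqrt \<alpha> * \<rho> z)"
    using bounded_measurable_linear_combination[OF b, of 1 "sqrt \<alpha>"] by simp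
  moreover have "distr_div_nonpos (\<lambda>z. \<psi> (u z + sqrt \<alpha> * \<rho> z)) (\<lambda>z. \<phi> (u z + sqrt \<alpha> * \<rho> z))"
    if "burgers_entropy_pair \<psi> \<phi>" for \<psi> \<phi>
  proof (rule ineq)
    show "coupled_entropy_pair \<alpha> (\<lambda>\<rho> u. \<psi> (u + sqrt \<alpha> * \<rho>)) (\<lambda>\<rho> u. \<phi> (u + sqrt \<alpha> * \<rho>))"
      unfolding coupled_entropy_pair_def
      using that by (intro exI[of _ 1] exI[of _ 0] exI[of _ \<psi>] exI[of _ \<phi>]) auto
  qed
  ultimately show "burgers_entropy_solution (\<lambda>z. u z + sqrt \<alpha> * \<rho> z)"
    by (simp add: burgers_entropy_solution_def)
  have "bounded_measurable (\<lambda>z. u z - sqrt \<alpha> * \<rho> z)"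
    using bounded_measurable_linear_combination[OF b, of 1 "- sqrt \<alpha>"] by simp
  moreover have "distr_div_nonpos (\<lambda>z. \<psi> (u z - sqrt \<alpha> * \<rho> z)) (\<lambda>z. \<phi> (u z - sqrt \<alpha> * \<rho> z))"
    if "burgers_entropy_pair \<psi> \<phi>" for \<psi> \<phi>
  proof (rule ineq)
    show "coupled_entropy_pair \<alpha> (\<lambda>\<rho> u. \<psi> (u - sqrt \<alpha> * \<rho>)) (\<lambda>\<rho> u. \<phi> (u - sqrt \<alpha> * \<rho>))"
      unfolding coupled_entropy_pair_def
      using that by (intro exI[of _ 0] exI[of _ 1] exI[of _ \<psi>] exI[of _ \<phi>]) auto
  qed
  ultimately show "burgers_entropy_solution (\<lambda>z. u z - sqrt \<alpha> * \<rho> z)"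
    by (simp add: burgers_entropy_solution_def)
qed

lemma coupled_entropy_solution_of_burgers:
  assumes \<alpha>: "\<alpha> > 0" and p: "burgers_entropy_solution f\<^sub>p" and m: "burgers_entropy_solution f\<^sub>m"
    and le: "\<And>z. z \<in> half_plane \<Longrightarrow> f\<^sub>m z \<le> f\<^sub>p z"
  shows "coupled_entropy_solution \<alpha>
    (\<lambda>z. (f\<^sub>p z - f\<^sub>m z) / (2 * sqrt \<alpha>)) (\<lambda>z. (f\<^sub>p z + f\<^sub>m z) / 2)"
proof -
  let ?\<rho> = "\<lambda>z. (f\<^sub>p z - f\<^sub>m z) / (2 * sqrt \<alpha>)" and ?u = "\<lambda>z. (f\<^sub>p z + f\<^sub>m z) / 2"
  have b: "bounded_measurable f\<^sub>p" "bounded_measurable f\<^sub>m"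
    using p m by (auto simp: burgers_entropy_solution_def)
  have "bounded_measurable ?\<rho>"
    using bounded_measurable_linear_combination[OF b, of "1 / (2 * sqrt \<alpha>)" "- 1 / (2 * sqrt \<alpha>)"]
    by (simp add: diff_divide_distrib)
  moreover have "bounded_measurable ?u"
    using bounded_measurable_linear_combination[OF b, of "1 / 2" "1 / 2"]
    by (simp add: add_divide_distrib)
  moreover have "0 \<le> ?\<rho> z" if "z \<in> half_plane" for z
    using le[OF that] \<alpha> by simp
  moreover have "distr_div_nonpos (\<lambda>z. \<eta> (?\<rho> z) (?u z)) (\<lambda>z. q (?\<rho> z) (?u z))"
    if pair: "coupled_entropy_pair \<alpha> \<eta> q" for \<eta> q
  proof -
    have inv: "?u z + sqrt \<alpha> * ?\<rho> z = f\<^sub>p z" "?u z - sqrt \<alpha> * ?\<rho> z = f\<^sub>m z" for z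
      using \<alpha> by (simp_all add: field_simps)
    obtain k\<^sub>1 k\<^sub>2 \<psi>\<^sub>1 \<psi>\<^sub>2 \<phi>\<^sub>1 \<phi>\<^sub>2 where k: "0 \<le> k\<^sub>1" "0 \<le> k\<^sub>2"
      and pairs: "burgers_entropy_pair \<psi>\<^sub>1 \<phi>\<^sub>1" "burgers_entropy_pair \<psi>\<^sub>2 \<phi>\<^sub>2"
      and eq: "\<eta> = (\<lambda>\<rho> u. k\<^sub>1 * \<psi>\<^sub>1 (u + sqrt \<alpha> * \<rho>) + k\<^sub>2 * \<psi>\<^sub>2 (u - sqrt \<alpha> * \<rho>))"
        "q = (\<lambda>\<rho> u. k\<^sub>1 * \<phi>\<^sub>1 (u + sqrt \<alpha> * \<rho>) + k\<^sub>2 * \<phi>\<^sub>2 (u - sqrt \<alpha> * \<rho>))"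
      using pair unfolding coupled_entropy_pair_def by (elim exE conjE) (rule that)
    have "distr_div_nonpos (\<lambda>z. k\<^sub>1 * \<psi>\<^sub>1 (f\<^sub>p z) + k\<^sub>2 * \<psi>\<^sub>2 (f\<^sub>m z))
        (\<lambda>z. k\<^sub>1 * \<phi>\<^sub>1 (f\<^sub>p z) + k\<^sub>2 * \<phi>\<^sub>2 (f\<^sub>m z))"
      using p m pairs k b
      by (intro distr_div_nonpos_linear_combination)
         (auto simp: burgers_entropy_solution_def
           intro: bounded_measurable_continuous_compose[OF b(1)]
             bounded_measurable_continuous_compose[OF b(2)] burgers_entropy_pair_continuous)
    then show ?thesis
      by (simp only: eq inv)
  qed
  ultimately show ?thesis
    by (simp add: coupled_entropy_solution_def)
qed

theorem proposition4p3:
  fixes \<alpha> :: real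
  assumes "\<alpha> > 0"
  shows "(\<forall>\<rho> u. coupled_entropy_solution \<alpha> \<rho> u \<longrightarrow>
            burgers_entropy_solution (\<lambda>z. u z + sqrt \<alpha> * \<rho> z) \<and>
            burgers_entropy_solution (\<lambda>z. u z - sqrt \<alpha> * \<rho> z)) \<and>
         (\<forall>f\<^sub>p f\<^sub>m. burgers_entropy_solution f\<^sub>p \<and> burgers_entropy_solution f\<^sub>m \<and>
            (\<forall>z\<in>half_plane. f\<^sub>p z \<ge> f\<^sub>m z) \<longrightarrow>
            coupled_entropy_solution \<alpha>
              (\<lambda>z. (f\<^sub>p z - f\<^sub>m z) / (2 * sqrt \<alpha>)) (\<lambda>z. (f\<^sub>p z + f\<^sub>m z) / 2))"
  using assms burgers_entropy_solution_of_coupled coupled_entropy_solution_of_burgers by blast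

end
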